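(* Let $\mathcal{P}$ be a family of probability measures on $\Omega=C([0,\infty);\mathbb{R}^k)$ with upper capacity $c$, and let $X:\Omega\times[0,\infty)\to\mathbb{R}$ be a stochastic process, i.e., $X_t$ is $\mathcal{B}(\Omega)$-measurable for each $t\ge0$. (i) $X$ has a quasi-continuous version on $\Omega\times[0,T]$ if and only if we can find a sequence $X^n\in C(\Omega\times[0,T])$ such that, for each $\varepsilon>0$, $$c\Big(\Big\{\sup_{0\le t\le T}|X^n_t-X_t|>\varepsilon\Big\}\Big)\to0\quad\text{as }n\to\infty.$$ Moreover, $X$ and this version are q.s. continuous in $t\in[0,T]$, i.e., continuous in $t\in[0,T]$ for q.s. $\omega\in\Omega$. (ii) $X$ has a quasi-continuous version on $\Omega\times[0,\infty)$ if and only if for each $T>0$ there exists a sequence $X^n\in C(\Omega\times[0,T])$ such that, for each $\varepsilon>0$, $c(\{\sup_{0\le t\le T}|X^n_t-X_t|>\varepsilon\})\to0$ as $n\to\infty$. Also, $X$ and this version are q.s. continuous in $t\in[0,\infty)$.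
   Context: $\Omega=C([0,\infty);\mathbb{R}^k)$ is the space of $\mathbb{R}^k$-valued continuous paths with the metric $\rho(\omega^1,\omega^2)=\sum_{N\ge1}2^{-N}[(\sup_{t\in[0,N]}|\omega^1_t-\omega^2_t|)\wedge1]$, and $\mathcal{B}(\Omega)$ is its Borel $\sigma$-algebra. The upper capacity is $c(A)=\sup_{P\in\mathcal{P}}P(A)$ for $A\in\mathcal{B}(\Omega)$. A set $A\in\mathcal{B}(\Omega)$ is polar if $c(A)=0$, and a property holds q.s. (quasi-surely) if it holds outside a polar set. $C(\Omega\times[0,T])$ is the set of real functions continuous in $(\omega,t)$ on $\Omega\times[0,T]$. A process $F=(F_t)_{t\ge0}$ is quasi-continuous on $\Omega\times[0,T]$ (resp. on $\Omega\times[0,\infty)$) if for each $\varepsilon>0$ there is an open set $G\subset\Omega$ with $c(G)<\varepsilon$ such that $(\omega,t)\mapsto F_t(\omega)$ is continuous on $G^c\times[0,T]$ (resp. $G^c\times[0,\infty)$). A process $X'$ is a version of (indistinguishable from) $X$ on $[0,T]$ (resp. $[0,\infty)$) if, q.s., $X'_t=X_t$ for all $t\in[0,T]$ (resp. all $t\in[0,\infty)$). "Has a quasi-continuous version" means that there is a quasi-continuous process which is a version of $X$ on the corresponding time interval. *)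

theory Defs
  imports "HOL-Probability.Probability"
begin

text \<open>
  The path space \<open>C([0,\<infinity>); \<real>\<^sup>k)\<close>. Paths are functions on all of \<open>\<real>\<close> that are \<open>undefined\<close> at
  negative times, so that two paths are equal iff they agree on \<open>[0,\<infinity>)\<close>.
\<close>

typedef ('k::finite) cpath =
  "{f :: real \<Rightarrow> real ^ 'k. continuous_on {0..} f \<and> f \<in> extensional {0..}}"
  morphisms path_at Abs_cpath
proof
  show "restrict (\<lambda>_. 0) {0..} \<in> {f :: real \<Rightarrow> real ^ 'k. continuous_on {0..} f \<and> f \<in> extensional {0..}}"
    by (auto intro: continuous_on_eq[of _ "\<lambda>_. 0"])
qed

definition sup_dist :: "real \<Rightarrow> 'k::finite cpath \<Rightarrow> 'k cpath \<Rightarrow> real" where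
  "sup_dist T v w = (SUP t\<in>{0..T}. norm (path_at v t - path_at w t))"

lemma continuous_on_path_at: "continuous_on {0..} (path_at w)"
  using path_at[of w] by auto

lemma bdd_above_path_diff: "bdd_above ((\<lambda>t. norm (path_at v t - path_at w t)) ` {0..T})"
proof -
  have "continuous_on {0..T} (\<lambda>t. norm (path_at v t - path_at w t))"
    by (intro continuous_intros continuous_on_subset[OF continuous_on_path_at]) auto
  then show ?thesis
    by (intro bounded_imp_bdd_above compact_imp_bounded compact_continuous_image) auto
qed

lemma norm_le_sup_dist: "0 \<le> t \<Longrightarrow> t \<le> T \<Longrightarrow> norm (path_at v t - path_at w t) \<le> sup_dist T v w"
  unfolding sup_dist_def by (intro cSUP_upper bdd_above_path_diff) auto

lemma sup_dist_nonneg: "0 \<le> T \<Longrightarrow> 0 \<le> sup_dist T v w"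
  by (rule order_trans[OF norm_ge_zero norm_le_sup_dist[of 0]]) auto

lemma sup_dist_triangle:
  assumes "0 \<le> T"
  shows "sup_dist T u w \<le> sup_dist T u v + sup_dist T w v"
  unfolding sup_dist_def[of T u w]
proof (rule cSUP_least)
  fix t assume t: "t \<in> {0..T}"
  have "norm (path_at u t - path_at w t)
      \<le> norm (path_at u t - path_at v t) + norm (path_at w t - path_at v t)"
    by (metis dist_norm dist_triangle2)
  also have "\<dots> \<le> sup_dist T u v + sup_dist T w v"
    using t by (intro add_mono norm_le_sup_dist) auto
  finally show "norm (path_at u t - path_at w t) \<le> sup_dist T u v + sup_dist T w v" .
qed (use assms in auto)

instantiation cpath :: (finite) metric_space
begin

text \<open>\<open>\<Sum>\<^sub>N\<^sub>\<ge>\<^sub>1 2\<^sup>-\<^sup>N [(sup\<^sub>0\<^sub>\<le>\<^sub>t\<^sub>\<le>\<^sub>N |v\<^sub>t - w\<^sub>t|) \<and> 1]\<close>, with the summation index shifted to start at 0.\<close>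

definition dist_cpath :: "'a cpath \<Rightarrow> 'a cpath \<Rightarrow> real" where
  "dist_cpath v w = (\<Sum>N. (1/2) ^ Suc N * min (sup_dist (real (Suc N)) v w) 1)"

definition uniformity_cpath :: "('a cpath \<times> 'a cpath) filter" where
  "uniformity_cpath = (INF e\<in>{0 <..}. principal {(x, y). dist x y < e})"

definition open_cpath :: "'a cpath set \<Rightarrow> bool" where
  "open_cpath U \<longleftrightarrow> (\<forall>x\<in>U. eventually (\<lambda>(x', y). x' = x \<longrightarrow> y \<in> U) uniformity)"

lemma summable_dist_cpath:
  "summable (\<lambda>N. (1/2) ^ Suc N * min (sup_dist (real (Suc N)) v w) (1::real))"
proof (rule summable_comparison_test')
  show "summable (\<lambda>N. (1/2::real) ^ Suc N)"
    using summable_mult[OF summable_geometric[of "1/2::real"], of "1/2"] by simp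
  show "norm ((1/2) ^ Suc N * min (sup_dist (real (Suc N)) v w) (1::real)) \<le> (1/2) ^ Suc N" for N
    using sup_dist_nonneg[of "real (Suc N)" v w]
    by (simp add: abs_mult min_def mult_left_le)
qed

instance
proof
  fix u v w :: "'a cpath"
  have nonneg: "0 \<le> (1/2) ^ Suc N * min (sup_dist (real (Suc N)) v w) (1::real)" for N v and w :: "'a cpath"
    using sup_dist_nonneg[of "real (Suc N)" v w] by simp
  show "dist v w = 0 \<longleftrightarrow> v = w"
  proof
    assume "dist v w = 0"
    then have z: "(1/2) ^ Suc N * min (sup_dist (real (Suc N)) v w) (1::real) = 0" for N
      using suminf_eq_zero_iff[OF summable_dist_cpath nonneg] unfolding dist_cpath_def by blast
    have "path_at v t = path_at w t" for t
    proof (cases "0 \<le> t")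
      case True
      obtain N where N: "t \<le> real N"
        using real_arch_simple by blast
      have "sup_dist (real (Suc N)) v w = 0"
        using z[of N] by (simp add: min_def split: if_splits)
      then show ?thesis
        using norm_le_sup_dist[of t "real (Suc N)" v w] True N by simp
    next
      case False
      then show ?thesis
        using path_at[of v] path_at[of w] by (simp add: extensional_def)
    qed
    then show "v = w"
      using path_at_inject by blast
  qed (simp add: dist_cpath_def sup_dist_def)
  show "dist u w \<le> dist u v + dist w v"
    unfolding dist_cpath_def suminf_add[OF summable_dist_cpath summable_dist_cpath]
  proof (intro suminf_le summable_add summable_dist_cpath)
    fix N
    show "(1/2) ^ Suc N * min (sup_dist (real (Suc N)) u w) (1::real)
        \<le> (1/2) ^ Suc N * min (sup_dist (real (Suc N)) u v) 1
          + (1/2) ^ Suc N * min (sup_dist (real (Suc N)) w v) 1"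
      unfolding distrib_left[symmetric]
      using sup_dist_triangle[of "real (Suc N)" u w v]
        sup_dist_nonneg[of "real (Suc N)" u v] sup_dist_nonneg[of "real (Suc N)" w v]
      by (intro mult_left_mono) auto
  qed
qed (simp_all add: uniformity_cpath_def open_cpath_def)

end

definition upper_capacity :: "'k::finite cpath measure set \<Rightarrow> 'k cpath set \<Rightarrow> ennreal" where
  "upper_capacity \<P> A = (SUP P\<in>\<P>. emeasure P A)"

text \<open>
  The capacity is only meaningful on Borel sets (\<open>emeasure\<close> is 0 on non-measurable sets). Since
  \<open>X\<close> is only measurable for each fixed time, the events \<open>{sup\<^sub>0\<^sub>\<le>\<^sub>t\<^sub>\<le>\<^sub>T |X\<^sup>n\<^sub>t - X\<^sub>t| > \<epsilon>}\<close> need not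
  be Borel; their capacity is understood as the infimum over Borel supersets. By monotonicity this
  agrees with \<open>upper_capacity\<close> on Borel sets, and it vanishes exactly on the subsets of polar
  sets, consistently with \<open>quasi_surely\<close> below.
\<close>

definition outer_capacity :: "'k::finite cpath measure set \<Rightarrow> 'k cpath set \<Rightarrow> ennreal" where
  "outer_capacity \<P> A = (INF B\<in>{B \<in> sets borel. A \<subseteq> B}. upper_capacity \<P> B)"

lemma outer_capacity_borel:
  assumes "\<And>P. P \<in> \<P> \<Longrightarrow> sets P = sets borel" and "A \<in> sets borel"
  shows "outer_capacity \<P> A = upper_capacity \<P> A"
proof (rule antisym)
  show "outer_capacity \<P> A \<le> upper_capacity \<P> A"
    unfolding outer_capacity_def using assms(2) by (intro INF_lower) auto
  show "upper_capacity \<P> A \<le> outer_capacity \<P> A"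
    unfolding outer_capacity_def upper_capacity_def
    using assms by (intro INF_greatest SUP_mono) (auto intro!: bexI emeasure_mono)
qed

definition polar :: "'k::finite cpath measure set \<Rightarrow> 'k cpath set \<Rightarrow> bool" where
  "polar \<P> A \<longleftrightarrow> A \<in> sets borel \<and> upper_capacity \<P> A = 0"

definition quasi_surely :: "'k::finite cpath measure set \<Rightarrow> ('k cpath \<Rightarrow> bool) \<Rightarrow> bool" where
  "quasi_surely \<P> Q \<longleftrightarrow> (\<exists>N. polar \<P> N \<and> (\<forall>\<omega>. \<omega> \<notin> N \<longrightarrow> Q \<omega>))"

text \<open>
  A process is written \<open>X t \<omega>\<close> for \<open>X\<^sub>t(\<omega>)\<close>; its values at negative times are irrelevant. Below, \<open>I\<close>
  is the time interval \<open>{0..T}\<close> or \<open>{0..}\<close>.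
\<close>

definition process :: "(real \<Rightarrow> 'k::finite cpath \<Rightarrow> real) \<Rightarrow> bool" where
  "process X \<longleftrightarrow> (\<forall>t\<ge>0. X t \<in> borel_measurable borel)"

definition quasi_continuous ::
    "'k::finite cpath measure set \<Rightarrow> real set \<Rightarrow> (real \<Rightarrow> 'k cpath \<Rightarrow> real) \<Rightarrow> bool" where
  "quasi_continuous \<P> I F \<longleftrightarrow>
     (\<forall>\<epsilon>::real. \<epsilon> > 0 \<longrightarrow> (\<exists>G. open G \<and> upper_capacity \<P> G < ennreal \<epsilon> \<and>
        continuous_on ((- G) \<times> I) (\<lambda>(\<omega>, t). F t \<omega>)))"

definition version_of ::
    "'k::finite cpath measure set \<Rightarrow> real set \<Rightarrow>
     (real \<Rightarrow> 'k cpath \<Rightarrow> real) \<Rightarrow> (real \<Rightarrow> 'k cpath \<Rightarrow> real) \<Rightarrow> bool" where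
  "version_of \<P> I X' X \<longleftrightarrow> quasi_surely \<P> (\<lambda>\<omega>. \<forall>t\<in>I. X' t \<omega> = X t \<omega>)"

definition quasi_continuous_version ::
    "'k::finite cpath measure set \<Rightarrow> real set \<Rightarrow>
     (real \<Rightarrow> 'k cpath \<Rightarrow> real) \<Rightarrow> (real \<Rightarrow> 'k cpath \<Rightarrow> real) \<Rightarrow> bool" where
  "quasi_continuous_version \<P> I Y X \<longleftrightarrow>
     process Y \<and> quasi_continuous \<P> I Y \<and> version_of \<P> I Y X"

text \<open>The supremum is taken in \<open>ereal\<close>, since it may be infinite for a given path.\<close>

definition uniform_capacity_limit ::
    "'k::finite cpath measure set \<Rightarrow> real \<Rightarrow>
     (nat \<Rightarrow> real \<Rightarrow> 'k cpath \<Rightarrow> real) \<Rightarrow> (real \<Rightarrow> 'k cpath \<Rightarrow> real) \<Rightarrow> bool" where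
  "uniform_capacity_limit \<P> T Xn X \<longleftrightarrow>
     (\<forall>\<epsilon>::real. \<epsilon> > 0 \<longrightarrow>
        (\<lambda>n. outer_capacity \<P> {\<omega>. (SUP t\<in>{0..T}. ereal \<bar>Xn n t \<omega> - X t \<omega>\<bar>) > ereal \<epsilon>})
          \<longlonglongrightarrow> 0)"

end

theory Submission
  imports Defs
begin

text \<open>
  A quasi-continuous process is continuous on a closed set \<open>(- G) \<times> [0,T]\<close> with \<open>G\<close> of small
  capacity, and Tietze's theorem extends it from there to a continuous function. Conversely, given
  continuous approximations \<open>Z\<^sub>k\<close> of \<open>X\<close>, fast in capacity, the exceptional sets
  \<open>{\<exists>t. |Z\<^sub>k\<^sub>+\<^sub>1 - Z\<^sub>k| > 2 \<cdot> 2\<^sup>-\<^sup>k}\<close> are open because the \<open>Z\<^sub>k\<close> are continuous, and have summable capacity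
  because both \<open>Z\<^sub>k\<close> and \<open>Z\<^sub>k\<^sub>+\<^sub>1\<close> are close to \<open>X\<close>. Off their tail unions the \<open>Z\<^sub>k\<close> converge uniformly,
  so that the limit is quasi-continuous. On \<open>[0,\<infinity>)\<close> the versions on \<open>[0,T]\<close> cannot simply be glued,
  since a polar set need not have open neighbourhoods of small capacity; instead \<open>Z\<^sub>k\<close> is chosen to
  approximate \<open>X\<close> on \<open>[0,k+1]\<close>.
\<close>

section \<open>Monotonicity, subadditivity and polar sets for the upper capacity\<close>

lemma upper_capacity_mono:
  assumes "\<And>P. P \<in> \<P> \<Longrightarrow> sets P = sets borel" "A \<subseteq> B" "B \<in> sets borel"
  shows "upper_capacity \<P> A \<le> upper_capacity \<P> B"
  unfolding upper_capacity_def using assms by (intro SUP_mono) (auto intro!: bexI emeasure_mono)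

lemma upper_capacity_subadditive_countably:
  assumes "\<And>P. P \<in> \<P> \<Longrightarrow> sets P = sets borel" "\<And>i. A i \<in> sets borel"
  shows "upper_capacity \<P> (\<Union>i::nat. A i) \<le> (\<Sum>i. upper_capacity \<P> (A i))"
  unfolding upper_capacity_def[of _ "\<Union>i. A i"]
proof (rule SUP_least)
  fix P assume P: "P \<in> \<P>"
  have "emeasure P (\<Union>i. A i) \<le> (\<Sum>i. emeasure P (A i))"
    using assms P by (intro emeasure_subadditive_countably) auto
  also have "\<dots> \<le> (\<Sum>i. upper_capacity \<P> (A i))"
    using P by (intro suminf_le) (auto simp: upper_capacity_def intro: SUP_upper)
  finally show "emeasure P (\<Union>i. A i) \<le> (\<Sum>i. upper_capacity \<P> (A i))" .
qed

lemma upper_capacity_Un: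
  assumes "\<And>P. P \<in> \<P> \<Longrightarrow> sets P = sets borel" "A \<in> sets borel" "B \<in> sets borel"
  shows "upper_capacity \<P> (A \<union> B) \<le> upper_capacity \<P> A + upper_capacity \<P> B"
  unfolding upper_capacity_def[of _ "A \<union> B"]
proof (rule SUP_least)
  fix P assume P: "P \<in> \<P>"
  have "emeasure P (A \<union> B) \<le> emeasure P A + emeasure P B"
    using assms P by (intro emeasure_subadditive) auto
  also have "\<dots> \<le> upper_capacity \<P> A + upper_capacity \<P> B"
    using P by (intro add_mono) (auto simp: upper_capacity_def intro: SUP_upper)
  finally show "emeasure P (A \<union> B) \<le> upper_capacity \<P> A + upper_capacity \<P> B" .
qed

text \<open>Countable subadditivity together with the geometric series started at \<open>m\<close>.
  This is the Borel-Cantelli estimate: it tends to 0, so the limsup of the \<open>B i\<close> is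
  polar.\<close>

lemma upper_capacity_tail_bound:
  assumes "\<And>P. P \<in> \<P> \<Longrightarrow> sets P = sets borel" "\<And>i. B i \<in> sets borel"
    and "\<And>i. upper_capacity \<P> (B i) \<le> ennreal ((1/2) ^ i)"
  shows "upper_capacity \<P> (\<Union>i\<in>{m..}. B i) \<le> ennreal (2 * (1/2) ^ m)"
proof -
  have sums: "(\<lambda>i. (1/2) ^ (i + m) :: real) sums (2 * (1/2) ^ m)"
    using sums_mult2[OF geometric_sums[of "1/2 :: real"], of "(1/2) ^ m"]
    by (simp add: power_add)
  have "{m..} = range (\<lambda>i. i + m)"
    by (auto simp: image_iff le_iff_add add.commute)
  then have "(\<Union>i\<in>{m..}. B i) = (\<Union>i. B (i + m))"
    by simp
  also have "upper_capacity \<P> \<dots> \<le> (\<Sum>i. upper_capacity \<P> (B (i + m)))"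
    using assms(1,2) by (rule upper_capacity_subadditive_countably)
  also have "\<dots> \<le> (\<Sum>i. ennreal ((1/2) ^ (i + m)))"
    using assms(3) by (intro suminf_le) auto
  also have "\<dots> = ennreal (2 * (1/2) ^ m)"
    using sums by (intro suminf_ennreal_eq) auto
  finally show ?thesis .
qed

lemma polar_if_small:
  assumes "N \<in> sets borel" "\<And>e::real. e > 0 \<Longrightarrow> upper_capacity \<P> N \<le> ennreal e"
  shows "polar \<P> N"
proof -
  have "upper_capacity \<P> N \<le> 0"
    by (rule ennreal_le_epsilon) (use assms(2) in auto)
  then show ?thesis
    using assms(1) by (simp add: polar_def)
qed

text \<open>The intersection lies in every single \<open>G n\<close>, so monotonicity suffices and
  the sets need not decrease. It applies both to the open sets of quasi-continuity and to
  Borel-Cantelli tails.\<close>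

lemma polar_INT:
  assumes "\<And>P. P \<in> \<P> \<Longrightarrow> sets P = sets borel" "\<And>n. G n \<in> sets borel"
    and "\<And>n. upper_capacity \<P> (G n) \<le> ennreal (d n)" "d \<longlonglongrightarrow> 0"
  shows "polar \<P> (\<Inter>n::nat. G n)"
proof (rule polar_if_small)
  show "(\<Inter>n. G n) \<in> sets borel"
    using assms(2) by auto
  fix e :: real assume "e > 0"
  then obtain n where n: "d n < e"
    using eventually_happens'[OF sequentially_bot order_tendstoD(2)[OF assms(4)]] by blast
  have "upper_capacity \<P> (\<Inter>n. G n) \<le> upper_capacity \<P> (G n)"
    using assms(1,2) by (intro upper_capacity_mono) auto
  also have "\<dots> \<le> ennreal (d n)"
    by (rule assms(3))
  also have "\<dots> \<le> ennreal e"
    using n by (intro ennreal_leI) simp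
  finally show "upper_capacity \<P> (\<Inter>n. G n) \<le> ennreal e" .
qed

section \<open>Quasi-sure continuity in time\<close>

lemma quasi_surely_elim2:
  assumes "\<And>P. P \<in> \<P> \<Longrightarrow> sets P = sets borel" "quasi_surely \<P> Q" "quasi_surely \<P> R"
    and "\<And>\<omega>. Q \<omega> \<Longrightarrow> R \<omega> \<Longrightarrow> S \<omega>"
  shows "quasi_surely \<P> S"
proof -
  obtain M N where MN: "polar \<P> M" "polar \<P> N" "\<And>\<omega>. \<omega> \<notin> M \<Longrightarrow> Q \<omega>" "\<And>\<omega>. \<omega> \<notin> N \<Longrightarrow> R \<omega>"
    using assms(2,3) by (auto simp: quasi_surely_def)
  then have "polar \<P> (M \<union> N)"
    using upper_capacity_Un[OF assms(1), of \<P> M N] by (auto simp: polar_def)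
  then show ?thesis
    using MN assms(4) by (auto simp: quasi_surely_def)
qed

text \<open>A path outside one of the exceptional open sets inherits continuity in time by
  composition with the slice map from \<open>t\<close> to \<open>(\<omega>, t)\<close>. Only paths
  in all of these sets can fail, and their capacities tend to 0.\<close>

lemma quasi_continuous_imp_quasi_surely_continuous:
  assumes "\<And>P. P \<in> \<P> \<Longrightarrow> sets P = sets borel" "quasi_continuous \<P> I Y"
  shows "quasi_surely \<P> (\<lambda>\<omega>. continuous_on I (\<lambda>t. Y t \<omega>))"
proof -
  have "\<exists>G. open G \<and> upper_capacity \<P> G < ennreal (1 / Suc n) \<and>
      continuous_on ((- G) \<times> I) (\<lambda>(\<omega>, t). Y t \<omega>)" for n
    using assms(2) by (auto simp: quasi_continuous_def)
  then obtain G where G: "\<And>n. open (G n)" "\<And>n. upper_capacity \<P> (G n) < ennreal (1 / Suc n)"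
    "\<And>n. continuous_on ((- G n) \<times> I) (\<lambda>(\<omega>, t). Y t \<omega>)"
    by metis
  have "polar \<P> (\<Inter>n. G n)"
    using assms(1) G(1,2) LIMSEQ_inverse_real_of_nat
    by (intro polar_INT[where d = "\<lambda>n. 1 / Suc n"]) (auto simp: divide_inverse intro: less_imp_le)
  moreover have "continuous_on I (\<lambda>t. Y t \<omega>)" if "\<omega> \<notin> (\<Inter>n. G n)" for \<omega>
  proof -
    obtain n where "\<omega> \<notin> G n"
      using \<open>\<omega> \<notin> (\<Inter>n. G n)\<close> by auto
    moreover have "continuous_on I (\<lambda>t. (\<omega>, t))"
      by (intro continuous_on_Pair continuous_on_const continuous_on_id)
    ultimately show ?thesis
      using continuous_on_compose2[OF G(3), of I "\<lambda>t. (\<omega>, t)" n] by auto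
  qed
  ultimately show ?thesis
    unfolding quasi_surely_def by blast
qed

lemma quasi_continuous_version_imp_quasi_surely_continuous:
  assumes "\<And>P. P \<in> \<P> \<Longrightarrow> sets P = sets borel" "quasi_continuous_version \<P> I Y X"
  shows "quasi_surely \<P> (\<lambda>\<omega>. continuous_on I (\<lambda>t. X t \<omega>))"
    and "quasi_surely \<P> (\<lambda>\<omega>. continuous_on I (\<lambda>t. Y t \<omega>))"
proof -
  show Y: "quasi_surely \<P> (\<lambda>\<omega>. continuous_on I (\<lambda>t. Y t \<omega>))"
    using assms by (intro quasi_continuous_imp_quasi_surely_continuous)
      (auto simp: quasi_continuous_version_def)
  have "quasi_surely \<P> (\<lambda>\<omega>. \<forall>t\<in>I. Y t \<omega> = X t \<omega>)"
    using assms(2) by (simp add: quasi_continuous_version_def version_of_def)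
  from assms(1) Y this show "quasi_surely \<P> (\<lambda>\<omega>. continuous_on I (\<lambda>t. X t \<omega>))"
    by (rule quasi_surely_elim2) (auto cong: continuous_on_cong)
qed

lemma quasi_continuous_version_subset:
  assumes "quasi_continuous_version \<P> I Y X" "J \<subseteq> I"
  shows "quasi_continuous_version \<P> J Y X"
  using assms unfolding quasi_continuous_version_def quasi_continuous_def version_of_def quasi_surely_def
  by (meson Sigma_mono continuous_on_subset subset_iff subset_refl)

section \<open>From quasi-continuity to continuous approximations\<close>

lemma Tietze_extension_closed_real:
  fixes f :: "'a::metric_space \<Rightarrow> real"
  assumes "closed S" "continuous_on S f"
  obtains g where "continuous_on UNIV g" "\<And>x. x \<in> S \<Longrightarrow> g x = f x"
\<comment> \<open>Taking \<open>UNIV\<close> as the target interval admits unbounded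
  \<open>f\<close>.\<close>
proof (rule Tietze_extension_realinterval[of euclidean S UNIV f])
  show "normal_space (euclidean :: 'a topology)"
    by (simp add: metrizable_imp_normal_space metrizable_space_euclidean)
qed (use assms that in auto)

text \<open>The Tietze extension \<open>g n\<close> equals \<open>Y\<close> off \<open>G n\<close>,
  and \<open>Y\<close> equals \<open>X\<close> off the polar set \<open>N\<close>. Hence the event
  of an error above any positive level lies in \<open>G n \<union> N\<close>, whose capacity is at
  most \<open>1 / Suc n\<close> whatever that level is.\<close>

lemma uniform_capacity_limit_of_quasi_continuous_version:
  assumes sets: "\<And>P. P \<in> \<P> \<Longrightarrow> sets P = sets borel"
    and Y: "quasi_continuous_version \<P> {0..T} Y X"
  shows "\<exists>Xn :: nat \<Rightarrow> _. (\<forall>n. continuous_on (UNIV \<times> {0..T}) (\<lambda>(\<omega>, t). Xn n t \<omega>)) \<and>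
    uniform_capacity_limit \<P> T Xn X"
proof -
  obtain N where N: "polar \<P> N" "\<And>\<omega> t. \<omega> \<notin> N \<Longrightarrow> t \<in> {0..T} \<Longrightarrow> Y t \<omega> = X t \<omega>"
    using Y unfolding quasi_continuous_version_def version_of_def quasi_surely_def by blast
  have "\<exists>G g. open G \<and> upper_capacity \<P> G < ennreal (1 / Suc n) \<and> continuous_on UNIV g \<and>
      (\<forall>\<omega> t. \<omega> \<notin> G \<longrightarrow> t \<in> {0..T} \<longrightarrow> g (\<omega>, t) = Y t \<omega>)" for n
  proof -
    obtain G where G: "open G" "upper_capacity \<P> G < ennreal (1 / Suc n)"
      "continuous_on ((- G) \<times> {0..T}) (\<lambda>(\<omega>, t). Y t \<omega>)"
      using Y unfolding quasi_continuous_version_def quasi_continuous_def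
      by (metis of_nat_0_less_iff zero_less_Suc zero_less_divide_1_iff)
    have "closed ((- G) \<times> {0..T})"
      using G(1) by (intro closed_Times) auto
    from Tietze_extension_closed_real[OF this G(3)] obtain g where "continuous_on UNIV g"
      "\<And>x. x \<in> (- G) \<times> {0..T} \<Longrightarrow> g x = (case x of (\<omega>, t) \<Rightarrow> Y t \<omega>)"
      by blast
    with G show ?thesis
      by (intro exI[of _ G] exI[of _ g]) auto
  qed
  then obtain G g where G: "\<And>n. open (G n)" "\<And>n. upper_capacity \<P> (G n) < ennreal (1 / Suc n)"
    and g: "\<And>n. continuous_on UNIV (g n)"
      "\<And>n \<omega> t. \<omega> \<notin> G n \<Longrightarrow> t \<in> {0..T} \<Longrightarrow> g n (\<omega>, t) = Y t \<omega>"
    by metis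
  have "(\<lambda>n. outer_capacity \<P> {\<omega>. (SUP t\<in>{0..T}. ereal \<bar>g n (\<omega>, t) - X t \<omega>\<bar>) > ereal \<epsilon>})
      \<longlonglongrightarrow> 0" if "\<epsilon> > 0" for \<epsilon> :: real
  proof (rule tendsto_sandwich[OF _ _ tendsto_const])
    show "\<forall>\<^sub>F n in sequentially. outer_capacity \<P>
      {\<omega>. (SUP t\<in>{0..T}. ereal \<bar>g n (\<omega>, t) - X t \<omega>\<bar>) > ereal \<epsilon>} \<le> ennreal (1 / Suc n)"
    proof (rule always_eventually, rule allI)
      fix n
      let ?A = "{\<omega>. (SUP t\<in>{0..T}. ereal \<bar>g n (\<omega>, t) - X t \<omega>\<bar>) > ereal \<epsilon>}"
      have "?A \<subseteq> G n \<union> N"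
      proof
        fix \<omega> assume "\<omega> \<in> ?A"
        then obtain t where "t \<in> {0..T}" "\<bar>g n (\<omega>, t) - X t \<omega>\<bar> > \<epsilon>"
          by (auto simp: less_SUP_iff)
        then show "\<omega> \<in> G n \<union> N"
          using g(2)[of \<omega> n t] N(2)[of \<omega> t] \<open>\<epsilon> > 0\<close> by - (rule ccontr, auto)
      qed
      \<comment> \<open>The event itself may fail to be Borel; this Borel superset bounds its outer
        capacity.\<close>
      moreover have "G n \<union> N \<in> sets borel"
        using G(1) N(1) by (auto simp: polar_def)
      ultimately have "outer_capacity \<P> ?A \<le> upper_capacity \<P> (G n \<union> N)"
        unfolding outer_capacity_def by (intro INF_lower) auto
      also have "\<dots> \<le> upper_capacity \<P> (G n) + upper_capacity \<P> N"
        using sets G(1) N(1) by (intro upper_capacity_Un) (auto simp: polar_def)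
      also have "\<dots> \<le> ennreal (1 / Suc n)"
        using G(2)[of n] N(1) by (simp add: polar_def)
      finally show "outer_capacity \<P> ?A \<le> ennreal (1 / Suc n)" .
    qed
    show "(\<lambda>n. ennreal (1 / Suc n)) \<longlonglongrightarrow> 0"
      using tendsto_ennrealI[OF LIMSEQ_inverse_real_of_nat] by (simp add: divide_inverse)
  qed auto
  moreover have "continuous_on (UNIV \<times> {0..T}) (\<lambda>(\<omega>, t). g n (\<omega>, t))" for n
    using continuous_on_subset[OF g(1)[of n] subset_UNIV] by simp
  ultimately show ?thesis
    unfolding uniform_capacity_limit_def by (intro exI[of _ "\<lambda>n t \<omega>. g n (\<omega>, t)"]) blast
qed

section \<open>From continuous approximations to a quasi-continuous version\<close>

lemma uniform_capacity_limitD: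
  assumes "uniform_capacity_limit \<P> T Xn X" "\<epsilon> > 0" "\<delta> > (0::real)"
  obtains n B where "B \<in> sets borel" "upper_capacity \<P> B < ennreal \<delta>"
    "\<And>\<omega> t. \<omega> \<notin> B \<Longrightarrow> t \<in> {0..T} \<Longrightarrow> \<bar>Xn n t \<omega> - X t \<omega>\<bar> \<le> \<epsilon>"
proof -
  have "\<forall>\<^sub>F n in sequentially. outer_capacity \<P>
      {\<omega>. (SUP t\<in>{0..T}. ereal \<bar>Xn n t \<omega> - X t \<omega>\<bar>) > ereal \<epsilon>} < ennreal \<delta>"
    using assms unfolding uniform_capacity_limit_def
    by (intro order_tendstoD(2)[where y = 0]) (auto simp: ennreal_less_zero_iff)
  then obtain n where "outer_capacity \<P>
      {\<omega>. (SUP t\<in>{0..T}. ereal \<bar>Xn n t \<omega> - X t \<omega>\<bar>) > ereal \<epsilon>} < ennreal \<delta>"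
    using eventually_happens'[OF sequentially_bot] by blast
  \<comment> \<open>An infimum below \<open>\<delta>\<close> is witnessed by a Borel superset whose
    capacity is below \<open>\<delta>\<close>.\<close>
  then obtain B where B: "B \<in> sets borel" "upper_capacity \<P> B < ennreal \<delta>"
    "{\<omega>. (SUP t\<in>{0..T}. ereal \<bar>Xn n t \<omega> - X t \<omega>\<bar>) > ereal \<epsilon>} \<subseteq> B"
    unfolding outer_capacity_def by (auto simp: INF_less_iff)
  show thesis
  proof (rule that[OF B(1,2)])
    fix \<omega> t assume "\<omega> \<notin> B" "t \<in> {0..T}"
    with B(3) have "\<not> (SUP t\<in>{0..T}. ereal \<bar>Xn n t \<omega> - X t \<omega>\<bar>) > ereal \<epsilon>"
      by blast
    with \<open>t \<in> {0..T}\<close> show "\<bar>Xn n t \<omega> - X t \<omega>\<bar> \<le> \<epsilon>"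
      by (auto simp: less_SUP_iff not_less)
  qed
qed

text \<open>With bounded \<open>I\<close> this serves part (i), with \<open>I = {0..}\<close> part (ii).\<close>

lemma quasi_continuous_version_of_approximations:
  fixes Z :: "nat \<Rightarrow> real \<Rightarrow> 'k::finite cpath \<Rightarrow> real"
  assumes sets: "\<And>P. P \<in> \<P> \<Longrightarrow> sets P = sets borel"
    and cont: "\<And>k. continuous_on (UNIV \<times> (I \<inter> {..real (Suc k)})) (\<lambda>(\<omega>, t). Z k t \<omega>)"
    and B: "\<And>k. B k \<in> sets borel" "\<And>k. upper_capacity \<P> (B k) \<le> ennreal ((1/2) ^ k)"
    and approx: "\<And>k \<omega> t. \<omega> \<notin> B k \<Longrightarrow> t \<in> I \<inter> {..real (Suc k)} \<Longrightarrow> \<bar>Z k t \<omega> - X t \<omega>\<bar> \<le> (1/2) ^ k"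
  shows "\<exists>Y. quasi_continuous_version \<P> I Y X"
proof -
  \<comment> \<open>\<open>Z k\<close> is controlled only on its time window. The default 0 makes
    \<open>W k t\<close> measurable at every time, also outside \<open>I\<close>; for fixed
    \<open>t\<close> in \<open>I\<close> it is taken for only finitely many
    \<open>k\<close>.\<close>
  define W where "W k t \<omega> = (if t \<in> I \<inter> {..real (Suc k)} then Z k t \<omega> else 0)" for k t \<omega>
  \<comment> \<open>As \<open>lim\<close> is total, \<open>Y\<close> is defined and measurable even
    where the sequence diverges.\<close>
  define Y where "Y t \<omega> = lim (\<lambda>k. W k t \<omega>)" for t \<omega>
  \<comment> \<open>Comparing \<open>Z (Suc k)\<close> with \<open>Z k\<close> instead of
    \<open>X\<close> makes the set open, whereas \<open>B k\<close> is merely Borel. The threshold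
    exceeds the sum \<open>(1/2) ^ k + (1/2) ^ Suc k\<close> of the two errors allowed off
    \<open>B k \<union> B (Suc k)\<close>.\<close>
  define G where "G k = (\<Union>t\<in>I \<inter> {..real (Suc k)}. {\<omega>. \<bar>Z (Suc k) t \<omega> - Z k t \<omega>\<bar> > 2 * (1/2) ^ k})"
    for k
  define U where "U m = (\<Union>k\<in>{m..}. G k)" for m
  have Zcont: "continuous_on UNIV (Z k t)" if "t \<in> I \<inter> {..real (Suc k)}" for k t
  proof -
    have "continuous_on UNIV (\<lambda>\<omega> :: 'k cpath. (\<omega>, t))"
      by (intro continuous_on_Pair continuous_on_const continuous_on_id)
    then show ?thesis
      using continuous_on_compose2[OF cont, of UNIV "\<lambda>\<omega>. (\<omega>, t)" k] that by auto
  qed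
  \<comment> \<open>A union of open sets over uncountably many times is still open.\<close>
  have G_open: "open (G k)" for k
    unfolding G_def
  proof (intro open_UN ballI open_Collect_less continuous_intros Zcont)
  qed auto
  then have U_open: "open (U m)" for m
    by (auto simp: U_def)
  have G_sub: "G k \<subseteq> B k \<union> B (Suc k)" for k
  proof
    fix \<omega> assume "\<omega> \<in> G k"
    then obtain t where t: "t \<in> I \<inter> {..real (Suc k)}" "\<bar>Z (Suc k) t \<omega> - Z k t \<omega>\<bar> > 2 * (1/2) ^ k"
      by (auto simp: G_def)
    then have t': "t \<in> I \<inter> {..real (Suc (Suc k))}"
      by auto
    show "\<omega> \<in> B k \<union> B (Suc k)"
    proof (rule ccontr)
      assume "\<omega> \<notin> B k \<union> B (Suc k)"
      then have "\<bar>Z k t \<omega> - X t \<omega>\<bar> \<le> (1/2) ^ k" "\<bar>Z (Suc k) t \<omega> - X t \<omega>\<bar> \<le> (1/2) ^ k / 2"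
        using approx[of \<omega> k t] approx[of \<omega> "Suc k" t] t(1) t' by auto
      moreover have "(0::real) \<le> (1/2) ^ k" by simp
      ultimately show False
        using t(2) by linarith
    qed
  qed
  have B_tail_borel: "(\<Union>k\<in>{m..}. B k) \<in> sets borel" for m
    using B(1) by auto
  \<comment> \<open>The tail union already contains both \<open>B k\<close> and
    \<open>B (Suc k)\<close>, so the capacity bound for \<open>U m\<close> needs no
    doubling.\<close>
  have U_sub: "U m \<subseteq> (\<Union>k\<in>{m..}. B k)" for m
    unfolding U_def using G_sub by (fastforce intro: le_SucI)
  have U_cap: "upper_capacity \<P> (U m) \<le> ennreal (2 * (1/2) ^ m)" for m
    using upper_capacity_mono[OF sets U_sub B_tail_borel]
      upper_capacity_tail_bound[OF sets B] by (rule order_trans)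
  have lim0: "(\<lambda>m. 2 * (1/2) ^ m :: real) \<longlonglongrightarrow> 0"
    by (intro tendsto_mult_right_zero LIMSEQ_power_zero) simp

  have "process Y"
    unfolding process_def
  proof (intro allI impI)
    fix t :: real
    have "W k t \<in> borel_measurable borel" for k
      using Zcont[of t k] borel_measurable_continuous_onI[of "Z k t"]
      by (cases "t \<in> I \<inter> {..real (Suc k)}") (auto simp: W_def[abs_def])
    then show "Y t \<in> borel_measurable borel"
      unfolding Y_def by (intro borel_measurable_lim_metric) auto
  qed
  moreover have "quasi_continuous \<P> I Y"
    unfolding quasi_continuous_def
  proof (intro allI impI)
    fix \<epsilon> :: real assume "\<epsilon> > 0"
    then obtain m where m: "2 * (1/2) ^ m < \<epsilon>"
      using eventually_happens'[OF sequentially_bot order_tendstoD(2)[OF lim0]] by blast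
    have le: "upper_capacity \<P> (U m) < ennreal \<epsilon>"
      using U_cap[of m] m \<open>\<epsilon> > 0\<close> by (auto intro: order_le_less_trans ennreal_lessI)
    \<comment> \<open>Convergence is uniform only up to a bounded time \<open>j\<close>, since the
      window of \<open>Z k\<close> ends at \<open>k + 1\<close>.\<close>
    have "continuous_on ((- U m) \<times> (I \<inter> {..real j})) (\<lambda>(\<omega>, t). Y t \<omega>)" for j
    proof -
      let ?K = "(- U m) \<times> (I \<inter> {..real j})"
      let ?f = "\<lambda>k (\<omega>, t). W k t \<omega>"
      \<comment> \<open>The increments form a telescoping series, to which the Weierstrass test
        applies.\<close>
      have "uniformly_convergent_on ?K (\<lambda>n x. \<Sum>k<n. ?f (Suc k) x - ?f k x)"
      proof (rule Weierstrass_m_test'_ev)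
        show "\<forall>\<^sub>F k in sequentially. \<forall>x\<in>?K. norm (?f (Suc k) x - ?f k x) \<le> 2 * (1/2) ^ k"
          \<comment> \<open>\<open>k \<ge> m\<close> gives \<open>G k \<subseteq> U m\<close>;
            \<open>k \<ge> j\<close> puts the times of \<open>?K\<close> into the windows of
            \<open>Z k\<close> and \<open>Z (Suc k)\<close>, where \<open>W\<close> is
            \<open>Z\<close>.\<close>
          using eventually_ge_at_top[of "max m j"]
        proof eventually_elim
          case (elim k)
          show ?case
          proof clarify
            fix \<omega> t assume \<omega>: "\<omega> \<notin> U m" and t: "t \<in> I" "t \<le> real j"
            then have "\<omega> \<notin> G k" "t \<in> I \<inter> {..real (Suc k)}"
              using elim by (auto simp: U_def)
            then show "norm (W (Suc k) t \<omega> - W k t \<omega>) \<le> 2 * (1/2) ^ k"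
              by (force simp: G_def W_def)
          qed
        qed
        show "summable (\<lambda>k. 2 * (1/2) ^ k :: real)"
          by (intro summable_mult summable_geometric) simp
      qed
      then obtain l where "uniform_limit ?K (\<lambda>n x. \<Sum>k<n. ?f (Suc k) x - ?f k x) l sequentially"
        by (auto simp: uniformly_convergent_on_def)
      then have "uniform_limit ?K (\<lambda>n x. ?f 0 x + (\<Sum>k<n. ?f (Suc k) x - ?f k x)) (\<lambda>x. ?f 0 x + l x) sequentially"
        by (intro uniform_limit_add uniform_limit_const)
      moreover have "?f 0 x + (\<Sum>k<n. ?f (Suc k) x - ?f k x) = ?f n x" for n x
        using sum_lessThan_telescope[of "\<lambda>k. ?f k x" n] by (cases x) simp
      ultimately have ul: "uniform_limit ?K ?f (\<lambda>x. ?f 0 x + l x) sequentially"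
        by simp
      have "continuous_on ?K (\<lambda>x. ?f 0 x + l x)"
      proof (rule uniform_limit_theorem[OF _ ul])
        show "\<forall>\<^sub>F n in sequentially. continuous_on ?K (?f n)"
          using eventually_ge_at_top[of j]
        proof eventually_elim
          case (elim n)
          then have "continuous_on ?K (\<lambda>(\<omega>, t). Z n t \<omega>)"
            by (intro continuous_on_subset[OF cont[of n]]) auto
          then show ?case
            by (rule continuous_on_eq) (use elim in \<open>auto simp: W_def\<close>)
        qed
      qed simp
      moreover have "?f 0 x + l x = (case x of (\<omega>, t) \<Rightarrow> Y t \<omega>)" if "x \<in> ?K" for x
        using tendsto_uniform_limitI[OF ul that] by (auto simp: Y_def limI split: prod.splits)
      ultimately show ?thesis
        by (rule continuous_on_eq)
    qed
    then have "continuous_on ((- U m) \<times> I) (\<lambda>(\<omega>, t). Y t \<omega>)"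
      unfolding continuous_on_eq_continuous_within
    proof (intro ballI)
      fix x assume *: "\<And>j. \<forall>x\<in>(- U m) \<times> (I \<inter> {..real j}).
          continuous (at x within (- U m) \<times> (I \<inter> {..real j})) (\<lambda>(\<omega>, t). Y t \<omega>)"
        and x: "x \<in> (- U m) \<times> I"
      obtain j where j: "snd x < real j"
        using reals_Archimedean2 by blast
      \<comment> \<open>Continuity is local: the open set of times below \<open>j\<close> is a
        neighbourhood of \<open>x\<close> that never sees the truncation.\<close>
      have "at x within (- U m) \<times> I = at x within (- U m) \<times> (I \<inter> {..real j})"
        by (rule at_within_nhd[of _ "UNIV \<times> {..<real j}"])
          (use j in \<open>auto intro!: open_Times simp: mem_Times_iff\<close>)
      then show "continuous (at x within (- U m) \<times> I) (\<lambda>(\<omega>, t). Y t \<omega>)"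
        using bspec[OF *[of j], of x] x j by (simp add: mem_Times_iff)
    qed
    then show "\<exists>G. open G \<and> upper_capacity \<P> G < ennreal \<epsilon> \<and>
        continuous_on ((- G) \<times> I) (\<lambda>(\<omega>, t). Y t \<omega>)"
      using U_open le by blast
  qed
  moreover have "version_of \<P> I Y X"
    unfolding version_of_def quasi_surely_def
  proof (intro exI conjI allI impI ballI)
    \<comment> \<open>By Borel-Cantelli the limsup of the \<open>B k\<close> is polar. Off it the
      error bound against \<open>X\<close> holds for all large \<open>k\<close>, so the limit
      \<open>Y\<close> is \<open>X\<close>.\<close>
    show "polar \<P> (\<Inter>m. \<Union>k\<in>{m..}. B k)"
      using sets B_tail_borel upper_capacity_tail_bound[OF sets B] lim0 by (rule polar_INT)
    fix \<omega> t assume "\<omega> \<notin> (\<Inter>m. \<Union>k\<in>{m..}. B k)" and t: "t \<in> I"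
    then obtain m where m: "\<And>k. k \<ge> m \<Longrightarrow> \<omega> \<notin> B k"
      by auto
    obtain j where j: "t < real j"
      using reals_Archimedean2 by blast
    have "\<forall>\<^sub>F k in sequentially. norm (W k t \<omega> - X t \<omega>) \<le> (1/2) ^ k"
      using eventually_ge_at_top[of "max m j"]
    proof eventually_elim
      case (elim k)
      then show ?case
        using approx[OF m, of k t] t j by (simp add: W_def)
    qed
    then have "(\<lambda>k. W k t \<omega> - X t \<omega>) \<longlonglongrightarrow> 0"
      by (rule Lim_null_comparison) (simp add: LIMSEQ_power_zero)
    then show "Y t \<omega> = X t \<omega>"
      unfolding Y_def by (intro limI) (simp add: LIM_zero_iff)
  qed
  ultimately show ?thesis
    unfolding quasi_continuous_version_def by blast
qed

text \<open>From the sequence belonging to \<open>k\<close>, one member is picked whose error and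
  exceptional capacity are both at most \<open>(1/2) ^ k\<close>. The horizon may depend on
  \<open>k\<close>: it is constant for a bounded interval and \<open>k + 1\<close> for the
  half-line.\<close>

lemma quasi_continuous_version_of_uniform_capacity_limits:
  assumes sets: "\<And>P. P \<in> \<P> \<Longrightarrow> sets P = sets borel"
    and lims: "\<And>k::nat. \<exists>T Xn. I \<inter> {..real (Suc k)} \<subseteq> {0..T} \<and>
      (\<forall>n. continuous_on (UNIV \<times> {0..T}) (\<lambda>(\<omega>, t). Xn n t \<omega>)) \<and> uniform_capacity_limit \<P> T Xn X"
  shows "\<exists>Y. quasi_continuous_version \<P> I Y X"
proof -
  have "\<exists>Z B. continuous_on (UNIV \<times> (I \<inter> {..real (Suc k)})) (\<lambda>(\<omega>, t). Z t \<omega>) \<and>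
      B \<in> sets borel \<and> upper_capacity \<P> B \<le> ennreal ((1/2) ^ k) \<and>
      (\<forall>\<omega> t. \<omega> \<notin> B \<longrightarrow> t \<in> I \<inter> {..real (Suc k)} \<longrightarrow> \<bar>Z t \<omega> - X t \<omega>\<bar> \<le> (1/2) ^ k)" for k
  proof -
    obtain T Xn where Xn: "I \<inter> {..real (Suc k)} \<subseteq> {0..T}"
      "\<And>n. continuous_on (UNIV \<times> {0..T}) (\<lambda>(\<omega>, t). Xn n t \<omega>)" "uniform_capacity_limit \<P> T Xn X"
      using lims[of k] by blast
    obtain n B where B: "B \<in> sets borel" "upper_capacity \<P> B < ennreal ((1/2) ^ k)"
      "\<And>\<omega> t. \<omega> \<notin> B \<Longrightarrow> t \<in> {0..T} \<Longrightarrow> \<bar>Xn n t \<omega> - X t \<omega>\<bar> \<le> (1/2) ^ k"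
      by (rule uniform_capacity_limitD[OF Xn(3), of "(1/2) ^ k" "(1/2) ^ k"]) (simp, simp, blast)
    have "continuous_on (UNIV \<times> (I \<inter> {..real (Suc k)})) (\<lambda>(\<omega>, t). Xn n t \<omega>)"
      using Xn(1) by (intro continuous_on_subset[OF Xn(2)[of n]]) auto
    with B Xn(1) show ?thesis
      by (intro exI[of _ "Xn n"] exI[of _ B]) (auto intro: less_imp_le)
  qed
  then obtain Z B where
    "\<And>k. continuous_on (UNIV \<times> (I \<inter> {..real (Suc k)})) (\<lambda>(\<omega>, t). Z k t \<omega>)"
    "\<And>k. B k \<in> sets borel" "\<And>k. upper_capacity \<P> (B k) \<le> ennreal ((1/2) ^ k)"
    "\<And>k \<omega> t. \<omega> \<notin> B k \<Longrightarrow> t \<in> I \<inter> {..real (Suc k)} \<Longrightarrow> \<bar>Z k t \<omega> - X t \<omega>\<bar> \<le> (1/2) ^ k"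
    by metis
  with sets show ?thesis
    by (rule quasi_continuous_version_of_approximations)
qed

theorem theorem4p1:
  fixes \<P> :: "'k::finite cpath measure set"
    and X :: "real \<Rightarrow> 'k cpath \<Rightarrow> real"
  assumes "\<And>P. P \<in> \<P> \<Longrightarrow> prob_space P"
    and "\<And>P. P \<in> \<P> \<Longrightarrow> sets P = sets borel"
    and "process X"
  shows
    "(\<forall>T\<ge>0.
        ((\<exists>Y. quasi_continuous_version \<P> {0..T} Y X) \<longleftrightarrow>
         (\<exists>Xn :: nat \<Rightarrow> real \<Rightarrow> 'k cpath \<Rightarrow> real.
            (\<forall>n. continuous_on (UNIV \<times> {0..T}) (\<lambda>(\<omega>, t). Xn n t \<omega>)) \<and>
            uniform_capacity_limit \<P> T Xn X)) \<and>
        (\<forall>Y. quasi_continuous_version \<P> {0..T} Y X \<longrightarrow>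
           quasi_surely \<P> (\<lambda>\<omega>. continuous_on {0..T} (\<lambda>t. X t \<omega>)) \<and>
           quasi_surely \<P> (\<lambda>\<omega>. continuous_on {0..T} (\<lambda>t. Y t \<omega>))))
     \<and>
     ((\<exists>Y. quasi_continuous_version \<P> {0..} Y X) \<longleftrightarrow>
        (\<forall>T>0. \<exists>Xn :: nat \<Rightarrow> real \<Rightarrow> 'k cpath \<Rightarrow> real.
           (\<forall>n. continuous_on (UNIV \<times> {0..T}) (\<lambda>(\<omega>, t). Xn n t \<omega>)) \<and>
           uniform_capacity_limit \<P> T Xn X)) \<and>
     (\<forall>Y. quasi_continuous_version \<P> {0..} Y X \<longrightarrow>
        quasi_surely \<P> (\<lambda>\<omega>. continuous_on {0..} (\<lambda>t. X t \<omega>)) \<and>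
        quasi_surely \<P> (\<lambda>\<omega>. continuous_on {0..} (\<lambda>t. Y t \<omega>)))"
proof (intro conjI allI impI)
  note sets = assms(2)
  fix T :: real assume "T \<ge> 0"
  show "(\<exists>Y. quasi_continuous_version \<P> {0..T} Y X) \<longleftrightarrow>
      (\<exists>Xn :: nat \<Rightarrow> real \<Rightarrow> 'k cpath \<Rightarrow> real.
        (\<forall>n. continuous_on (UNIV \<times> {0..T}) (\<lambda>(\<omega>, t). Xn n t \<omega>)) \<and>
        uniform_capacity_limit \<P> T Xn X)"
  proof
    assume "\<exists>Y. quasi_continuous_version \<P> {0..T} Y X"
    then show "\<exists>Xn :: nat \<Rightarrow> real \<Rightarrow> 'k cpath \<Rightarrow> real.
        (\<forall>n. continuous_on (UNIV \<times> {0..T}) (\<lambda>(\<omega>, t). Xn n t \<omega>)) \<and> uniform_capacity_limit \<P> T Xn X"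
      using uniform_capacity_limit_of_quasi_continuous_version[OF sets] by blast
  next
    assume "\<exists>Xn :: nat \<Rightarrow> real \<Rightarrow> 'k cpath \<Rightarrow> real.
        (\<forall>n. continuous_on (UNIV \<times> {0..T}) (\<lambda>(\<omega>, t). Xn n t \<omega>)) \<and> uniform_capacity_limit \<P> T Xn X"
    then show "\<exists>Y. quasi_continuous_version \<P> {0..T} Y X"
      by (intro quasi_continuous_version_of_uniform_capacity_limits[OF sets] exI[of _ T]) auto
  qed
next
  show "(\<exists>Y. quasi_continuous_version \<P> {0..} Y X) \<longleftrightarrow>
      (\<forall>T>0. \<exists>Xn :: nat \<Rightarrow> real \<Rightarrow> 'k cpath \<Rightarrow> real.
        (\<forall>n. continuous_on (UNIV \<times> {0..T}) (\<lambda>(\<omega>, t). Xn n t \<omega>)) \<and>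
        uniform_capacity_limit \<P> T Xn X)"
  proof (intro iffI allI impI)
    fix T :: real
    assume "\<exists>Y. quasi_continuous_version \<P> {0..} Y X"
    moreover have "{0..T} \<subseteq> {0..}"
      by auto
    ultimately obtain Y where "quasi_continuous_version \<P> {0..T} Y X"
      using quasi_continuous_version_subset by blast
    with assms(2) show "\<exists>Xn :: nat \<Rightarrow> real \<Rightarrow> 'k cpath \<Rightarrow> real.
        (\<forall>n. continuous_on (UNIV \<times> {0..T}) (\<lambda>(\<omega>, t). Xn n t \<omega>)) \<and> uniform_capacity_limit \<P> T Xn X"
      by (rule uniform_capacity_limit_of_quasi_continuous_version)
  next
    assume lims: "\<forall>T>0. \<exists>Xn :: nat \<Rightarrow> real \<Rightarrow> 'k cpath \<Rightarrow> real.
        (\<forall>n. continuous_on (UNIV \<times> {0..T}) (\<lambda>(\<omega>, t). Xn n t \<omega>)) \<and> uniform_capacity_limit \<P> T Xn X"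
    show "\<exists>Y. quasi_continuous_version \<P> {0..} Y X"
    proof (rule quasi_continuous_version_of_uniform_capacity_limits[OF assms(2)])
      fix k :: nat
      show "\<exists>T Xn. {0..} \<inter> {..real (Suc k)} \<subseteq> {0..T} \<and>
          (\<forall>n. continuous_on (UNIV \<times> {0..T}) (\<lambda>(\<omega>, t). Xn n t \<omega>)) \<and> uniform_capacity_limit \<P> T Xn X"
        using lims[rule_format, of "real (Suc k)"] by (intro exI[of _ "real (Suc k)"]) auto
    qed
  qed
\<comment> \<open>What remains is quasi-sure continuity of \<open>X\<close> and of its version, on
  \<open>{0..T}\<close> and on \<open>{0..}\<close>.\<close>
qed (use quasi_continuous_version_imp_quasi_surely_continuous[OF assms(2)] in blast)+

end
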